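(* Let $X$ be a compact metric space and let $T:X\to X$ be a continuous map. Suppose that the set $\mathcal{M}_p$ of $T$-periodic measures is dense in the space $\mathcal{M}(T)$ of $T$-invariant Borel probability measures on $X$, endowed with the weak topology. Then $$\underline{\mathcal{R}}=\{\mu\in\mathcal{M}(T)\mid \underline{R}(x)=0 \text{ for } \mu\text{-a.e. } x\}$$ is a residual subset of $\mathcal{M}(T)$.
   Context: $\mathcal{M}(T)$ carries the weak topology ($\mu_\alpha\to\mu$ iff $\int f\,d\mu_\alpha\to\int f\,d\mu$ for every bounded continuous $f:X\to\mathbb{R}$). $\mathcal{M}_p$ is the set of measures of the form $\mu_x=\frac{1}{k_x}\sum_{i=0}^{k_x-1}\delta_{T^i x}$, where $x\in X$ is a $T$-periodic point of period $k_x$. The return time of $x\in X$ to the open ball $B(x,s)$ is $\tau_s(x)=\inf\{k\in\mathbb{N}\mid T^kx\in B(x,s)\}$ (with $k\geq 1$), and the lower recurrence rate of $x$ is $\underline{R}(x)=\liminf_{s\to 0}\frac{\log\tau_s(x)}{-\log s}$. A subset of a topological space is residual if it contains a countable intersection of open dense sets. *)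

theory Defs
  imports "HOL-Probability.Probability" "HOL-Combinatorics.Cycles"
begin

section \<open>Invariant and periodic measures\<close>

definition invariant_measures :: "('a::metric_space \<Rightarrow> 'a) \<Rightarrow> 'a measure set" where
  "invariant_measures T =
     {\<mu>. sets \<mu> = sets borel \<and> prob_space \<mu> \<and> distr \<mu> borel T = \<mu>}"

text \<open>
  The normalised sum of point masses along the orbit of a periodic point. The period is the
  least positive one, \<^term>\<open>least_power T x\<close>.
\<close>

definition periodic_measure :: "('a::metric_space \<Rightarrow> 'a) \<Rightarrow> 'a \<Rightarrow> 'a measure" where
  "periodic_measure T x =
     measure_of UNIV (sets borel)
       (\<lambda>A. (\<Sum>i<least_power T x. emeasure (return borel ((T ^^ i) x)) A)
              / ennreal (real (least_power T x)))"

definition periodic_measures :: "('a::metric_space \<Rightarrow> 'a) \<Rightarrow> 'a measure set" where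
  "periodic_measures T = {periodic_measure T x | x. \<exists>k>0. (T ^^ k) x = x}"


section \<open>The weak topology\<close>

text \<open>
  The coarsest topology on the invariant measures making \<open>\<mu> \<mapsto> \<integral> f d\<mu>\<close> continuous for every bounded
  continuous \<open>f\<close>; the lemma \<open>limitin_weak_topology\<close> below describes its convergence
  along arbitrary filters (hence along nets).
\<close>

definition weak_topology :: "('a::metric_space \<Rightarrow> 'a) \<Rightarrow> 'a measure topology" where
  "weak_topology T = topology_generated_by
     {{\<mu> \<in> invariant_measures T. (\<integral>x. f x \<partial>\<mu>) \<in> U} | (f :: 'a \<Rightarrow> real) U.
        continuous_on UNIV f \<and> bounded (range f) \<and> open U}"

definition residual_in :: "'b topology \<Rightarrow> 'b set \<Rightarrow> bool" where
  "residual_in X S \<longleftrightarrow> S \<subseteq> topspace X \<and>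
     (\<exists>\<U>. countable \<U> \<and> (\<forall>U\<in>\<U>. openin X U \<and> X closure_of U = topspace X) \<and>
           topspace X \<inter> \<Inter>\<U> \<subseteq> S)"


section \<open>Return times and recurrence rates\<close>

text \<open>The infimum of the empty set is \<^term>\<open>\<infinity> :: enat\<close>: a point that does not return has infinite
  return time.\<close>

definition return_time :: "('a::metric_space \<Rightarrow> 'a) \<Rightarrow> real \<Rightarrow> 'a \<Rightarrow> enat" where
  "return_time T s x = (INF k\<in>{k. 1 \<le> k \<and> (T ^^ k) x \<in> ball x s}. enat k)"

text \<open>The argument is only ever a return time, which is at least \<open>1\<close>.\<close>

definition log_enat :: "enat \<Rightarrow> ereal" where
  "log_enat n = (case n of enat k \<Rightarrow> ereal (ln (real k)) | \<infinity> \<Rightarrow> \<infinity>)"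

definition lower_recurrence_rate :: "('a::metric_space \<Rightarrow> 'a) \<Rightarrow> 'a \<Rightarrow> ereal" where
  "lower_recurrence_rate T x =
     Liminf (at_right 0) (\<lambda>s. log_enat (return_time T s x) / ereal (- ln s))"


section \<open>Basic properties\<close>

lemma topspace_weak_topology: "topspace (weak_topology T) = invariant_measures T"
proof -
  have "\<exists>f U. invariant_measures T = {\<mu> \<in> invariant_measures T. (\<integral>x. f x \<partial>\<mu>) \<in> U} \<and>
        continuous_on UNIV (f :: 'a \<Rightarrow> real) \<and> bounded (range f) \<and> open U"
    by (rule exI[of _ "\<lambda>_. 0"], rule exI[of _ UNIV]) auto
  then show ?thesis
    unfolding weak_topology_def topology_generated_by_topspace by blast
qed

lemma limitin_weak_topology:
  "limitin (weak_topology T) M \<mu> F \<longleftrightarrow>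
     \<mu> \<in> invariant_measures T \<and> (\<forall>\<^sub>F i in F. M i \<in> invariant_measures T) \<and>
     (\<forall>f :: 'a::metric_space \<Rightarrow> real. continuous_on UNIV f \<and> bounded (range f) \<longrightarrow>
        ((\<lambda>i. \<integral>x. f x \<partial>M i) \<longlongrightarrow> (\<integral>x. f x \<partial>\<mu>)) F)" (is "?L \<longleftrightarrow> ?R")
proof
  assume L: ?L
  then have \<mu>: "\<mu> \<in> invariant_measures T"
    by (simp add: limitin_def topspace_weak_topology)
  have ev: "\<forall>\<^sub>F i in F. M i \<in> U" if "openin (weak_topology T) U" "\<mu> \<in> U" for U
    using L that by (simp add: limitin_def)
  have "\<forall>\<^sub>F i in F. M i \<in> invariant_measures T"
    using ev[OF openin_topspace] \<mu> by (simp add: topspace_weak_topology)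
  moreover have "((\<lambda>i. \<integral>x. f x \<partial>M i) \<longlongrightarrow> (\<integral>x. f x \<partial>\<mu>)) F"
    if f: "continuous_on UNIV f" "bounded (range f)" for f :: "'a \<Rightarrow> real"
  proof (rule topological_tendstoI)
    fix U :: "real set" assume U: "open U" "(\<integral>x. f x \<partial>\<mu>) \<in> U"
    have "openin (weak_topology T) {\<mu> \<in> invariant_measures T. (\<integral>x. f x \<partial>\<mu>) \<in> U}"
      unfolding weak_topology_def by (rule topology_generated_by_Basis) (use f U in blast)
    from ev[OF this] show "\<forall>\<^sub>F i in F. (\<integral>x. f x \<partial>M i) \<in> U"
      using \<mu> U by (auto elim: eventually_mono)
  qed
  ultimately show ?R using \<mu> by blast
next
  assume R: ?R
  let ?S = "{{\<mu> \<in> invariant_measures T. (\<integral>x. f x \<partial>\<mu>) \<in> U} | (f :: 'a \<Rightarrow> real) U.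
        continuous_on UNIV f \<and> bounded (range f) \<and> open U}"
  have "\<forall>\<^sub>F i in F. M i \<in> U" if "generate_topology_on ?S U" "\<mu> \<in> U" for U
    using that
  proof (induction rule: generate_topology_on.induct)
    case Empty
    then show ?case by simp
  next
    case (Int a b)
    then show ?case by (auto intro: eventually_conj)
  next
    case (UN K)
    then obtain k where k: "k \<in> K" "\<mu> \<in> k" by blast
    from UN.IH[OF this] show ?case by (rule eventually_mono) (use k in blast)
  next
    case (Basis s)
    then obtain f U where f: "s = {\<mu> \<in> invariant_measures T. (\<integral>x. f x \<partial>\<mu>) \<in> U}"
      "continuous_on UNIV (f :: 'a \<Rightarrow> real)" "bounded (range f)" "open U" by blast
    then have "\<forall>\<^sub>F i in F. (\<integral>x. f x \<partial>M i) \<in> U"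
      using R Basis.prems by (intro topological_tendstoD[where l = "\<integral>x. f x \<partial>\<mu>"]) auto
    with R show ?case unfolding f by (auto elim: eventually_elim2)
  qed
  then show ?L
    using R unfolding limitin_def topspace_weak_topology
    by (auto simp: weak_topology_def openin_topology_generated_by_iff)
qed

lemma space_periodic_measure [simp]: "space (periodic_measure T x) = UNIV"
  and sets_periodic_measure [simp]: "sets (periodic_measure T x) = sets borel"
  using sets.sigma_sets_eq[of "borel :: 'a measure"]
  by (simp_all add: periodic_measure_def space_measure_of_conv sets_measure_of_conv)

lemma emeasure_periodic_measure:
  assumes "A \<in> sets borel"
  shows "emeasure (periodic_measure T x) A =
    (\<Sum>i<least_power T x. indicator A ((T ^^ i) x)) / ennreal (real (least_power T x))"
proof -
  let ?\<nu> = "\<lambda>A. (\<Sum>i<least_power T x. emeasure (return borel ((T ^^ i) x)) A)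
              / ennreal (real (least_power T x))"
  have "countably_additive (sets (borel :: 'a measure)) ?\<nu>"
  proof (rule countably_additiveI)
    fix A :: "nat \<Rightarrow> 'a set"
    assume A: "range A \<subseteq> sets borel" "disjoint_family A" "(\<Union>i. A i) \<in> sets borel"
    have "(\<Sum>n. ?\<nu> (A n)) = (\<Sum>i<least_power T x. \<Sum>n. emeasure (return borel ((T ^^ i) x)) (A n))
              / ennreal (real (least_power T x))"
      by (simp add: divide_ennreal_def suminf_sum)
    also have "\<dots> = ?\<nu> (\<Union>i. A i)"
      using A by (subst suminf_emeasure) auto
    finally show "(\<Sum>n. ?\<nu> (A n)) = ?\<nu> (\<Union>i. A i)" .
  qed
  then have "emeasure (periodic_measure T x) A = ?\<nu> A"
    using assms by (intro emeasure_measure_of[OF periodic_measure_def])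
      (auto simp: positive_def)
  with assms show ?thesis by simp
qed

lemma periodic_measures_subset:
  assumes T: "continuous_on UNIV T"
  shows "periodic_measures T \<subseteq> invariant_measures T"
proof
  fix \<mu> assume "\<mu> \<in> periodic_measures T"
  then obtain x k where \<mu>: "\<mu> = periodic_measure T x" and k: "k > 0" "(T ^^ k) x = x"
    by (auto simp: periodic_measures_def)
  define p where "p = least_power T x"
  have p: "(T ^^ p) x = x" "p > 0"
    using least_powerI[OF k(2,1)] by (auto simp: p_def)
  have meas: "T \<in> borel_measurable borel"
    using T by (rule borel_measurable_continuous_onI)
  have "emeasure \<mu> (space \<mu>) = 1"
    using p by (simp add: \<mu> emeasure_periodic_measure p_def[symmetric]
        ennreal_of_nat_eq_real_of_nat divide_ennreal)
  then have "prob_space \<mu>" by (rule prob_spaceI)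
  moreover have "distr \<mu> borel T = \<mu>"
  proof (rule measure_eqI)
    fix A assume "A \<in> sets (distr \<mu> borel T)"
    then have A: "A \<in> sets borel" by simp
    let ?c = "indicator A ((T ^^ 0) x) :: ennreal"
    have "?c + (\<Sum>i<p. indicator A ((T ^^ Suc i) x))
        = (\<Sum>i<Suc p. indicator A ((T ^^ i) x) :: ennreal)"
      by (subst sum.lessThan_Suc_shift) simp
    also have "\<dots> = ?c + (\<Sum>i<p. indicator A ((T ^^ i) x))"
      using p by (simp add: add.commute)
    finally have "(\<Sum>i<p. indicator A ((T ^^ Suc i) x)) = (\<Sum>i<p. indicator A ((T ^^ i) x) :: ennreal)"
      unfolding ennreal_add_left_cancel by (auto split: split_indicator_asm)
    moreover have "T -` A \<in> sets borel"
      using measurable_sets[OF meas A] by simp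
    moreover have "emeasure (distr \<mu> borel T) A = emeasure \<mu> (T -` A)"
      using A meas by (subst emeasure_distr) (auto simp: \<mu> measurable_def)
    ultimately show "emeasure (distr \<mu> borel T) A = emeasure \<mu> A"
      using A by (simp add: \<mu> emeasure_periodic_measure p_def indicator_def)
  qed (simp add: \<mu>)
  ultimately show "\<mu> \<in> invariant_measures T"
    by (simp add: invariant_measures_def \<mu>)
qed

end

theory Submission
  imports Defs
begin

text \<open>
  The points returning within distance \<open>s\<close> at some time \<open>k\<close> with \<open>ln k < - e ln s\<close>, for some
  \<open>s < e\<close>, form an open set that contains all periodic points. By lower semicontinuity of
  \<open>\<mu> \<mapsto> \<mu> A\<close> for open \<open>A\<close>, giving it mass greater than \<open>1 - \<delta>\<close> is an open condition on \<open>\<mu>\<close>,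
  and a dense one because periodic measures give it mass \<open>1\<close>. Letting \<open>e\<close> and \<open>\<delta>\<close> run through
  null sequences yields the residual set.
\<close>

definition fast_return_set :: "('a::metric_space \<Rightarrow> 'a) \<Rightarrow> real \<Rightarrow> 'a set" where
  "fast_return_set T e =
     {x. \<exists>s k. 0 < s \<and> s < e \<and> 1 \<le> k \<and> ln (real k) < - e * ln s \<and> dist x ((T ^^ k) x) < s}"

lemma continuous_on_funpow:
  fixes T :: "'a::topological_space \<Rightarrow> 'a"
  assumes "continuous_on UNIV T"
  shows "continuous_on UNIV (T ^^ k)"
proof (induction k)
  case 0
  then show ?case by (simp add: id_def)
next
  case (Suc k)
  then show ?case
    using continuous_on_compose[OF Suc continuous_on_subset[OF assms]] by simp
qed

text \<open>Once \<open>s\<close> and \<open>k\<close> are fixed, only the distance condition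
  involves the point, and it bounds a continuous function strictly from above.\<close>

lemma open_fast_return_set:
  assumes "continuous_on UNIV T"
  shows "open (fast_return_set T e)"
proof -
  have eq: "fast_return_set T e =
    (\<Union>s\<in>{0<..<e}. \<Union>k\<in>{k. 1 \<le> k \<and> ln (real k) < - e * ln s}. {x. dist x ((T ^^ k) x) < s})"
    by (auto simp: fast_return_set_def)
  have "open {x. dist x ((T ^^ k) x) < s}" for k s
    by (intro open_Collect_less continuous_intros continuous_on_funpow assms)
  then show ?thesis
    unfolding eq by (intro open_UN ballI)
qed

text \<open>The return at time \<open>k\<close> is exact, so \<open>s\<close> may shrink with
  \<open>k\<close> fixed until \<open>- e * ln s\<close> exceeds \<open>ln k\<close>.\<close>

lemma fast_return_set_periodic:
  assumes "0 < e" "k > 0" "(T ^^ k) x = x"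
  shows "x \<in> fast_return_set T e"
proof -
  \<comment> \<open>The first term secures \<open>s < e\<close>; the second gives
    \<open>- e * ln s \<ge> ln k + 1\<close>, where the summand 1 makes the required inequality
    strict.\<close>
  define s where "s = min (e / 2) (exp (- (ln (real k) + 1) / e))"
  have "0 < s" "s < e" using assms by (auto simp: s_def)
  moreover have "ln s \<le> - (ln (real k) + 1) / e"
    using \<open>0 < s\<close> by (metis exp_le_cancel_iff exp_ln min.cobounded2 s_def)
  then have "ln (real k) < - e * ln s"
    using assms by (simp add: field_simps)
  ultimately show ?thesis
    using assms unfolding fast_return_set_def
    by (intro CollectI exI[of _ s] exI[of _ k]) auto
qed

lemma log_enat_nonneg: "0 \<le> log_enat n"
  by (cases n; cases "the_enat n") (auto simp: log_enat_def)

lemma log_enat_le: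
  assumes "n \<le> enat k" "1 \<le> k"
  shows "log_enat n \<le> ereal (ln (real k))"
proof -
  from assms obtain m where "n = enat m" "m \<le> k" by (cases n) auto
  \<comment> \<open>Monotonicity of \<open>ln\<close> handles positive \<open>m\<close>; at
    \<open>m = 0\<close> the default \<open>ln 0 = 0\<close> is at most \<open>ln k\<close> because
    \<open>1 \<le> k\<close>.\<close>
  then show ?thesis using assms by (cases "m = 0") (auto simp: log_enat_def)
qed

lemma lower_recurrence_rate_nonneg: "0 \<le> lower_recurrence_rate T x"
  unfolding lower_recurrence_rate_def
proof (rule Liminf_bounded)
  have "\<forall>\<^sub>F s in at_right (0::real). s \<in> {0<..<1}"
    by (rule eventually_at_right_real) simp
  then show "\<forall>\<^sub>F s in at_right 0. 0 \<le> log_enat (return_time T s x) / ereal (- ln s)"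
    by eventually_elim
      (auto intro!: zero_le_divide_ereal log_enat_nonneg)
qed

text \<open>Level \<open>n\<close> supplies a scale below \<open>1 / Suc n\<close> at which the
  quotient is also below \<open>1 / Suc n\<close>. Along these scales, which tend to 0, the quotient
  tends to 0, so no positive lower bound survives near 0.\<close>

lemma lower_recurrence_rate_eq_0:
  assumes "\<And>n. x \<in> fast_return_set T (1 / real (Suc n))"
  shows "lower_recurrence_rate T x = 0"
proof (rule antisym[OF _ lower_recurrence_rate_nonneg], rule ccontr)
  assume "\<not> lower_recurrence_rate T x \<le> 0"
  then obtain y where y: "0 < y" "ereal y < lower_recurrence_rate T x"
    using ereal_dense2[of 0 "lower_recurrence_rate T x"] by (auto simp: not_le)
  then have "\<forall>\<^sub>F s in at_right 0. ereal y < log_enat (return_time T s x) / ereal (- ln s)"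
    unfolding lower_recurrence_rate_def by (intro less_LiminfD)
  then obtain b where b: "b > 0"
    and large: "\<And>s. 0 < s \<Longrightarrow> s < b \<Longrightarrow> ereal y < log_enat (return_time T s x) / ereal (- ln s)"
    by (auto simp: eventually_at_right_field)
  \<comment> \<open>Being below \<open>b\<close> puts the scale \<open>s\<close> where
    \<open>large\<close> applies; being below \<open>y\<close> makes the quotient there contradict
    it.\<close>
  obtain n where n: "1 / real (Suc n) < min b y"
    using nat_approx_posE[of "min b y"] b y by auto
  define e where "e = 1 / real (Suc n)"
  from assms[of n] obtain s k where sk: "0 < s" "s < e" "1 \<le> k"
    "ln (real k) < - e * ln s" "dist x ((T ^^ k) x) < s"
    by (auto simp: fast_return_set_def e_def)
  \<comment> \<open>This forces \<open>s < 1\<close>, so dividing by \<open>- ln s\<close> preserves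
    inequalities.\<close>
  have "e \<le> 1" by (simp add: e_def)
  with sk have pos: "0 < - ln s" by simp
  have "return_time T s x \<le> enat k"
    unfolding return_time_def using sk by (intro INF_lower) (auto simp: dist_commute)
  then have "log_enat (return_time T s x) \<le> ereal (ln (real k))"
    using sk by (intro log_enat_le)
  then have "log_enat (return_time T s x) / ereal (- ln s) \<le> ereal (ln (real k)) / ereal (- ln s)"
    using pos by (intro ereal_divide_right_mono) auto
  also have "\<dots> = ereal (ln (real k) / - ln s)"
    using pos by simp
  also have "\<dots> \<le> ereal y"
  proof -
    have "ln (real k) / - ln s < e"
      using sk pos by (subst pos_divide_less_eq) auto
    then show ?thesis using n by (simp add: e_def)
  qed
  finally show False using large[of s] sk n by (auto simp: e_def)
qed

text \<open>The indicator of an open set is a pointwise limit from below of bounded continuous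
  functions, so the set in question is a union of subbasic open sets, one for each approximating
  function.\<close>

lemma openin_weak_topology_measure_greater:
  assumes A: "open A"
  shows "openin (weak_topology T) {\<mu> \<in> invariant_measures T. c < measure \<mu> A}"
\<comment> \<open>This case is separate because \<open>infdist x {} = 0\<close> by convention, which
  would make the approximating functions vanish.\<close>
proof (cases "A = UNIV")
  case True
  have "measure \<mu> A = 1" if "\<mu> \<in> invariant_measures T" for \<mu>
  proof -
    from that have "prob_space \<mu>" "space \<mu> = A"
      using True sets_eq_imp_space_eq[of \<mu> borel] by (auto simp: invariant_measures_def)
    then show ?thesis using prob_space.prob_space by metis
  qed
  then have "{\<mu> \<in> invariant_measures T. c < measure \<mu> A} = (if c < 1 then invariant_measures T else {})"
    by auto
  then show ?thesis
    using openin_topspace[of "weak_topology T"] by (simp add: topspace_weak_topology)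
next
  case False
  \<comment> \<open>Each \<open>f j\<close> vanishes off \<open>A\<close>; at a point of
    \<open>A\<close> it equals 1 as soon as \<open>j\<close> exceeds the reciprocal of the distance
    to the complement.\<close>
  define f where "f j x = min 1 (real j * infdist x (- A))" for j :: nat and x
  have f_cont: "continuous_on UNIV (f j)" for j
    unfolding f_def by (intro continuous_intros)
  have f_bounds: "0 \<le> f j x" "f j x \<le> 1" for j x
    by (auto simp: f_def infdist_nonneg)
  have f_zero: "f j x = 0" if "x \<notin> A" for j x
    using that by (simp add: f_def)
  have f_lim: "(\<lambda>j. f j x) \<longlonglongrightarrow> indicator A x" for x
  proof (cases "x \<in> A")
    case True
    then have "infdist x (- A) > 0"
      using A False in_closed_iff_infdist_zero[of "- A" x] infdist_nonneg[of x "- A"]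
      by (auto simp: closed_Compl order_less_le)
    then obtain m where m: "1 < real m * infdist x (- A)"
      using ex_less_of_nat_mult by blast
    have "\<forall>\<^sub>F j in sequentially. f j x = 1"
    proof (rule eventually_sequentiallyI[of m])
      fix j assume "m \<le> j"
      then have "real m * infdist x (- A) \<le> real j * infdist x (- A)"
        by (intro mult_right_mono) (auto simp: infdist_nonneg)
      with m show "f j x = 1" by (simp add: f_def)
    qed
    with True show ?thesis by (simp add: tendsto_eventually)
  qed (simp add: f_zero)
  \<comment> \<open>Dominated convergence yields a suitable \<open>j\<close>; conversely, each
    integral is at most the measure since \<open>f j\<close> lies below the indicator.\<close>
  have approx: "c < measure \<mu> A \<longleftrightarrow> (\<exists>j. c < (\<integral>x. f j x \<partial>\<mu>))"
    if "\<mu> \<in> invariant_measures T" for \<mu>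
  proof -
    from that interpret prob_space \<mu> by (simp add: invariant_measures_def)
    have [measurable_cong]: "sets \<mu> = sets borel"
      using that by (simp add: invariant_measures_def)
    have [measurable]: "A \<in> sets \<mu>" "\<And>j. f j \<in> borel_measurable \<mu>"
      using A borel_measurable_continuous_onI[OF f_cont] by auto
    have "(\<lambda>j. \<integral>x. f j x \<partial>\<mu>) \<longlonglongrightarrow> (\<integral>x. indicator A x \<partial>\<mu>)"
      by (rule integral_dominated_convergence[where w = "\<lambda>_. 1"]) (auto simp: f_lim f_bounds)
    then have lim: "(\<lambda>j. \<integral>x. f j x \<partial>\<mu>) \<longlonglongrightarrow> measure \<mu> A" by simp
    have "(\<integral>x. f j x \<partial>\<mu>) \<le> (\<integral>x. indicator A x \<partial>\<mu>)" for j
    proof (rule integral_mono)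
      show "integrable \<mu> (f j)"
        by (rule integrable_const_bound[where B = 1]) (auto simp: f_bounds)
      show "f j x \<le> indicator A x" for x
        using f_bounds f_zero by (cases "x \<in> A") auto
    qed (simp add: less_top[symmetric])
    then have "(\<integral>x. f j x \<partial>\<mu>) \<le> measure \<mu> A" for j by simp
    moreover have "\<exists>j. c < (\<integral>x. f j x \<partial>\<mu>)" if "c < measure \<mu> A"
      using order_tendstoD(1)[OF lim that] by (auto simp: eventually_sequentially)
    ultimately show ?thesis using less_le_trans by blast
  qed
  have "openin (weak_topology T) {\<mu> \<in> invariant_measures T. (\<integral>x. f j x \<partial>\<mu>) \<in> {c<..}}" for j
    unfolding weak_topology_def
  proof (rule topology_generated_by_Basis)
    have "bounded (range (f j))"
      by (rule boundedI[where B = 1]) (auto simp: f_bounds)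
    then show "{\<mu> \<in> invariant_measures T. (\<integral>x. f j x \<partial>\<mu>) \<in> {c<..}} \<in>
      {{\<mu> \<in> invariant_measures T. (\<integral>x. f x \<partial>\<mu>) \<in> U} | (f :: 'a \<Rightarrow> real) U.
        continuous_on UNIV f \<and> bounded (range f) \<and> open U}"
      using f_cont by (intro CollectI exI[of _ "f j"] exI[of _ "{c<..}"]) simp
  qed
  then have "openin (weak_topology T)
    (\<Union>j. {\<mu> \<in> invariant_measures T. (\<integral>x. f j x \<partial>\<mu>) \<in> {c<..}})"
    by blast
  also have "(\<Union>j. {\<mu> \<in> invariant_measures T. (\<integral>x. f j x \<partial>\<mu>) \<in> {c<..}}) =
    {\<mu> \<in> invariant_measures T. c < measure \<mu> A}"
    using approx by auto
  finally show ?thesis .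
qed

lemma measure_periodic_measure_eq_1:
  assumes "A \<in> sets borel" "k > 0" "(T ^^ k) x = x"
    and orbit: "\<And>i. (T ^^ i) x \<in> A"
  shows "measure (periodic_measure T x) A = 1"
proof -
  have "least_power T x > 0"
    using least_powerI[OF assms(3,2)] by simp
  then have "emeasure (periodic_measure T x) A = 1"
    using assms by (simp add: emeasure_periodic_measure ennreal_of_nat_eq_real_of_nat divide_ennreal)
  then show ?thesis by (simp add: measure_def)
qed

lemma measure_periodic_measures_fast_return_set:
  assumes T: "continuous_on UNIV T" and "0 < e" and "\<mu> \<in> periodic_measures T"
  shows "measure \<mu> (fast_return_set T e) = 1"
proof -
  from assms(3) obtain x k where \<mu>: "\<mu> = periodic_measure T x" and k: "k > 0" "(T ^^ k) x = x"
    by (auto simp: periodic_measures_def)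
  \<comment> \<open>Every orbit point has period \<open>k\<close> too, so the whole orbit carrying
    the measure lies in the fast return set.\<close>
  have "(T ^^ k) ((T ^^ i) x) = (T ^^ i) x" for i
    using k(2) by (metis add.commute comp_apply funpow_add)
  then show ?thesis
    unfolding \<mu> using k \<open>0 < e\<close> open_fast_return_set[OF T]
    by (intro measure_periodic_measure_eq_1[of _ k] fast_return_set_periodic[of e k]) auto
qed

text \<open>Letting \<open>m\<close> grow forces full mass for each \<open>n\<close>; countably many
  full-measure conditions then hold simultaneously almost everywhere.\<close>

lemma AE_lower_recurrence_rate_eq_0:
  assumes T: "continuous_on UNIV T" and \<mu>: "\<mu> \<in> invariant_measures T"
    and full: "\<And>n m. 1 - 1 / real (Suc m) < measure \<mu> (fast_return_set T (1 / real (Suc n)))"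
  shows "AE x in \<mu>. lower_recurrence_rate T x = 0"
proof -
  from \<mu> interpret prob_space \<mu> by (simp add: invariant_measures_def)
  have "AE x in \<mu>. x \<in> fast_return_set T (1 / real (Suc n))" for n
  proof -
    let ?A = "fast_return_set T (1 / real (Suc n))"
    have "?A \<in> events"
      using \<mu> open_fast_return_set[OF T] by (auto simp: invariant_measures_def)
    moreover have "prob ?A = 1"
    proof (rule ccontr)
      assume "prob ?A \<noteq> 1"
      then have "0 < 1 - prob ?A" using prob_le_1[of ?A] by linarith
      then obtain m where "1 / real (Suc m) < 1 - prob ?A" by (rule nat_approx_posE)
      with full[of m n] show False by linarith
    qed
    ultimately show ?thesis by (simp add: prob_eq_1)
  qed
  then have "AE x in \<mu>. \<forall>n. x \<in> fast_return_set T (1 / real (Suc n))"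
    by (simp add: AE_all_countable)
  then show ?thesis
    by eventually_elim (auto intro: lower_recurrence_rate_eq_0)
qed

theorem corollary1p2:
  fixes T :: "'a::metric_space \<Rightarrow> 'a"
  assumes "compact (UNIV :: 'a set)"
    and "continuous_on UNIV T"
    and "weak_topology T closure_of periodic_measures T = invariant_measures T"
  shows "residual_in (weak_topology T)
           {\<mu> \<in> invariant_measures T. AE x in \<mu>. lower_recurrence_rate T x = 0}"
proof -
  define U where "U n m = {\<mu> \<in> invariant_measures T.
    1 - 1 / real (Suc m) < measure \<mu> (fast_return_set T (1 / real (Suc n)))}" for n m
  have "openin (weak_topology T) (U n m)" for n m
    unfolding U_def by (intro openin_weak_topology_measure_greater open_fast_return_set assms)
  moreover have "weak_topology T closure_of U n m = topspace (weak_topology T)" for n m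
  proof -
    \<comment> \<open>Mass 1 exceeds every threshold, so \<open>U n m\<close> inherits density from
      the periodic measures.\<close>
    have "periodic_measures T \<subseteq> U n m"
      using periodic_measures_subset[OF assms(2)]
        measure_periodic_measures_fast_return_set[OF assms(2), of "1 / real (Suc n)"]
      by (auto simp: U_def)
    from closure_of_mono[OF this, of "weak_topology T"] show ?thesis
      using closure_of_subset_topspace[of "weak_topology T" "U n m"] assms(3)
      by (auto simp: topspace_weak_topology)
  qed
  moreover have "\<Inter> (range (\<lambda>(n, m). U n m)) \<subseteq>
    {\<mu> \<in> invariant_measures T. AE x in \<mu>. lower_recurrence_rate T x = 0}"
  proof (intro subsetI)
    fix \<mu> assume "\<mu> \<in> \<Inter> (range (\<lambda>(n, m). U n m))"
    then have "\<mu> \<in> U n m" for n m by auto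
    then show "\<mu> \<in> {\<mu> \<in> invariant_measures T. AE x in \<mu>. lower_recurrence_rate T x = 0}"
      using AE_lower_recurrence_rate_eq_0[OF assms(2), of \<mu>] by (simp add: U_def)
  qed
  ultimately show ?thesis
    \<comment> \<open>The family is countable as it is indexed by pairs of naturals;
      \<open>le_infI2\<close> discards the intersection with the whole space.\<close>
    unfolding residual_in_def
    by (intro conjI exI[of _ "range (\<lambda>(n, m). U n m)"] le_infI2)
      (auto simp: topspace_weak_topology)
qed

end
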